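(* Let $R$ be a ring. Then the following three statements are equivalent: (1) $R$ is a semi-regular $W\Delta U$ ring. (2) $R$ is an exchange $W\Delta U$ ring. (3) $R$ is a semi-weakly Boolean ring.
   Context: Rings are associative with identity, not necessarily commutative. $J(R)$ is the Jacobson radical and $U(R)$ the group of units of $R$. $\Delta(R)=\{r\in R : r+u\in U(R)\text{ for all }u\in U(R)\}$; equivalently $\Delta(R)=J(T)$, where $T$ is the subring of $R$ generated by $U(R)$. $R$ is $W\Delta U$ if $U(R)=\pm 1+\Delta(R)$, i.e. every unit of $R$ has the form $1+d$ or $-1+d$ with $d\in\Delta(R)$. $R$ is semi-regular if $R/J(R)$ is von Neumann regular and all idempotents lift modulo $J(R)$. $R$ is exchange if for every $a\in R$ there is an idempotent $e\in aR$ with $1-e\in(1-a)R$. A ring $S$ is weakly Boolean if for every $a\in S$ either $a$ or $-a$ is an idempotent. $R$ is semi-weakly Boolean if $R/J(R)$ is weakly Boolean and idempotents lift modulo $J(R)$. *)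

theory Defs
  imports "HOL-Algebra.Algebra"
begin

text \<open>
  Rings are the associative, unital, not necessarily commutative rings of \<^locale>\<open>ring\<close>
  (the zero ring is included). HOL-Algebra has only two-sided ideals, so left ideals are
  defined here for the Jacobson radical.
\<close>

definition left_ideal :: "'a set \<Rightarrow> ('a, 'b) ring_scheme \<Rightarrow> bool" where
  "left_ideal I R \<longleftrightarrow>
     additive_subgroup I R \<and> (\<forall>r\<in>carrier R. \<forall>x\<in>I. r \<otimes>\<^bsub>R\<^esub> x \<in> I)"

definition maximal_left_ideal :: "'a set \<Rightarrow> ('a, 'b) ring_scheme \<Rightarrow> bool" where
  "maximal_left_ideal M R \<longleftrightarrow>
     left_ideal M R \<and> M \<noteq> carrier R \<and>
     (\<forall>I. left_ideal I R \<and> M \<subseteq> I \<longrightarrow> I = M \<or> I = carrier R)"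

text \<open>The Jacobson radical is the intersection of all maximal left ideals; relative to the
  carrier, so that the zero ring, which has none, is its own radical.\<close>

definition jacobson_radical :: "('a, 'b) ring_scheme \<Rightarrow> 'a set" where
  "jacobson_radical R = {x \<in> carrier R. \<forall>M. maximal_left_ideal M R \<longrightarrow> x \<in> M}"

definition Delta :: "('a, 'b) ring_scheme \<Rightarrow> 'a set" where
  "Delta R = {r \<in> carrier R. \<forall>u\<in>Units R. r \<oplus>\<^bsub>R\<^esub> u \<in> Units R}"

definition WDeltaU :: "('a, 'b) ring_scheme \<Rightarrow> bool" where
  "WDeltaU R \<longleftrightarrow> Units R = {\<one>\<^bsub>R\<^esub>, \<ominus>\<^bsub>R\<^esub> \<one>\<^bsub>R\<^esub>} <+>\<^bsub>R\<^esub> Delta R"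

text \<open>Not the constant \<open>idempotent\<close> of HOL-Algebra, which is about order-theoretic maps.\<close>

definition idempotent_elem :: "('a, 'b) ring_scheme \<Rightarrow> 'a \<Rightarrow> bool" where
  "idempotent_elem R e \<longleftrightarrow> e \<in> carrier R \<and> e \<otimes>\<^bsub>R\<^esub> e = e"

definition idempotents_lift_modulo :: "('a, 'b) ring_scheme \<Rightarrow> 'a set \<Rightarrow> bool" where
  "idempotents_lift_modulo R I \<longleftrightarrow>
     (\<forall>f. idempotent_elem (R Quot I) f \<longrightarrow> (\<exists>e. idempotent_elem R e \<and> I +>\<^bsub>R\<^esub> e = f))"

definition von_neumann_regular :: "('a, 'b) ring_scheme \<Rightarrow> bool" where
  "von_neumann_regular R \<longleftrightarrow>
     (\<forall>a\<in>carrier R. \<exists>x\<in>carrier R. a \<otimes>\<^bsub>R\<^esub> x \<otimes>\<^bsub>R\<^esub> a = a)"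

definition semi_regular :: "('a, 'b) ring_scheme \<Rightarrow> bool" where
  "semi_regular R \<longleftrightarrow>
     von_neumann_regular (R Quot jacobson_radical R) \<and>
     idempotents_lift_modulo R (jacobson_radical R)"

definition principal_right_ideal :: "('a, 'b) ring_scheme \<Rightarrow> 'a \<Rightarrow> 'a set" where
  "principal_right_ideal R a = {a \<otimes>\<^bsub>R\<^esub> x | x. x \<in> carrier R}"

definition exchange_ring :: "('a, 'b) ring_scheme \<Rightarrow> bool" where
  "exchange_ring R \<longleftrightarrow>
     (\<forall>a\<in>carrier R. \<exists>e. idempotent_elem R e \<and> e \<in> principal_right_ideal R a \<and>
        \<one>\<^bsub>R\<^esub> \<ominus>\<^bsub>R\<^esub> e \<in> principal_right_ideal R (\<one>\<^bsub>R\<^esub> \<ominus>\<^bsub>R\<^esub> a))"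

definition weakly_boolean :: "('a, 'b) ring_scheme \<Rightarrow> bool" where
  "weakly_boolean S \<longleftrightarrow>
     (\<forall>a\<in>carrier S. idempotent_elem S a \<or> idempotent_elem S (\<ominus>\<^bsub>S\<^esub> a))"

definition semi_weakly_boolean :: "('a, 'b) ring_scheme \<Rightarrow> bool" where
  "semi_weakly_boolean R \<longleftrightarrow>
     weakly_boolean (R Quot jacobson_radical R) \<and>
     idempotents_lift_modulo R (jacobson_radical R)"

end

theory Submission
  imports Defs
begin

text \<open>An exchange ring $R$ has a nonzero idempotent in every right ideal not contained in $J(R)$, and
  this passes to $S = R/J(R)$, as does the property $W\Delta U$. If $S$ were not reduced, it would
  contain a corner of $2 \times 2$ matrices, which the condition $U(S) = \pm 1 + \Delta(S)$ excludes;
  so idempotents of $S$ are central. Looking at the corner of an idempotent in $(a - a^3)S$ shows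
  $a^3 = a$ for all $a \in S$. Therefore $\Delta(S) = 0$, so $a + 1 - a^2$, whose square is $1$,
  equals $\pm 1$, which says that $a$ or $-a$ is idempotent. Conversely, a unit of a weakly Boolean
  ring is $\pm 1$, and semi-regular rings are exchange by Nicholson's lifting argument.\<close>

text \<open>The sign in WDeltaU varies with the unit, and the only handle on an element of
  \<open>Delta\<close> is to add a unit of one's choice. Both exclusions (of matrix units, and of
  \<open>a - a^3\<close> being nonzero) therefore prepare two units, one for each sign, chosen so
  that either case produces the same singular element: \<open>1 + p + q\<close> in the first,
  \<open>1 - e\<close> in the second. Exchange reaches the quotient only as semipotence: every
  nonzero principal right ideal contains a nonzero idempotent. Stated this way it already forces the
  radical of the quotient to vanish, so that radical is never computed. The radical is defined by
  left ideals while exchange speaks of right ideals, hence the membership tests from both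
  sides.\<close>

context ring
begin

text \<open>The library equips the \<open>algebra\<close> method for noncommutative rings with all the ring axioms
  except this one.\<close>

lemmas [algebra ring "ring.zero R" "ring.add R" "a_inv R" "a_minus R" "monoid.one R" "monoid.mult R"] = r_one

subsection \<open>One-sided characterizations of the Jacobson radical\<close>

lemma left_idealI:
  assumes "I \<subseteq> carrier R" "\<zero> \<in> I"
    and add: "\<And>x y. x \<in> I \<Longrightarrow> y \<in> I \<Longrightarrow> x \<oplus> y \<in> I"
    and mult: "\<And>r x. r \<in> carrier R \<Longrightarrow> x \<in> I \<Longrightarrow> r \<otimes> x \<in> I"
  shows "left_ideal I R"
proof -
  have "\<ominus> x \<in> I" if "x \<in> I" for x
    using mult[of "\<ominus> \<one>" x] that assms(1) by (auto simp: l_minus)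
  then have "subgroup I (add_monoid R)"
    using assms by (intro add.subgroupI) auto
  then show ?thesis
    using mult by (simp add: left_ideal_def additive_subgroupI)
qed

lemma left_idealD:
  assumes "left_ideal I R"
  shows "I \<subseteq> carrier R" "\<zero> \<in> I"
    "\<And>x y. x \<in> I \<Longrightarrow> y \<in> I \<Longrightarrow> x \<oplus> y \<in> I"
    "\<And>x. x \<in> I \<Longrightarrow> \<ominus> x \<in> I"
    "\<And>r x. r \<in> carrier R \<Longrightarrow> x \<in> I \<Longrightarrow> r \<otimes> x \<in> I"
proof -
  interpret additive_subgroup I R
    using assms by (simp add: left_ideal_def)
  show "I \<subseteq> carrier R" "\<zero> \<in> I" "\<And>x y. x \<in> I \<Longrightarrow> y \<in> I \<Longrightarrow> x \<oplus> y \<in> I"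
    by (auto simp: a_subset)
  show mult: "r \<otimes> x \<in> I" if "r \<in> carrier R" "x \<in> I" for r x
    using assms that by (simp add: left_ideal_def)
  show "\<ominus> x \<in> I" if "x \<in> I" for x
    using mult[of "\<ominus> \<one>" x] that by (auto simp: l_minus a_Hcarr)
qed

lemma left_ideal_eq_carrier_iff:
  assumes "left_ideal I R"
  shows "I = carrier R \<longleftrightarrow> \<one> \<in> I"
proof
  assume "\<one> \<in> I"
  then have "r \<in> I" if "r \<in> carrier R" for r
    using left_idealD(5)[OF assms that \<open>\<one> \<in> I\<close>] that by simp
  then show "I = carrier R"
    using left_idealD(1)[OF assms] by blast
qed simp

lemma left_ideal_add_principal:
  assumes M: "left_ideal M R" and x: "x \<in> carrier R"
  shows "left_ideal {m \<oplus> r \<otimes> x | m r. m \<in> M \<and> r \<in> carrier R} R" (is "left_ideal ?I R")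
proof (rule left_idealI)
  note D = left_idealD[OF M]
  show "?I \<subseteq> carrier R"
    using D(1) x by auto
  have "\<zero> = \<zero> \<oplus> \<zero> \<otimes> x"
    using x by simp
  then show "\<zero> \<in> ?I"
    using D(2) by blast
  fix y z assume "y \<in> ?I" "z \<in> ?I"
  then obtain m r n s where yz: "y = m \<oplus> r \<otimes> x" "z = n \<oplus> s \<otimes> x"
    and c: "m \<in> M" "n \<in> M" "r \<in> carrier R" "s \<in> carrier R"
    by blast
  have "m \<in> carrier R" "n \<in> carrier R"
    using c D(1) by auto
  with c x have "y \<oplus> z = (m \<oplus> n) \<oplus> (r \<oplus> s) \<otimes> x"
    unfolding yz by algebra
  then show "y \<oplus> z \<in> ?I"
    using c D(3) by blast
next
  note D = left_idealD[OF M]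
  fix t y assume t: "t \<in> carrier R" and "y \<in> ?I"
  then obtain m r where y: "y = m \<oplus> r \<otimes> x" and c: "m \<in> M" "r \<in> carrier R"
    by blast
  have "m \<in> carrier R"
    using c D(1) by auto
  with c x t have "t \<otimes> y = t \<otimes> m \<oplus> (t \<otimes> r) \<otimes> x"
    unfolding y by algebra
  then show "t \<otimes> y \<in> ?I"
    using c t D(5) by blast
qed

lemma left_ideal_principal:
  assumes x: "x \<in> carrier R"
  shows "left_ideal {r \<otimes> x | r. r \<in> carrier R} R"
proof (rule left_idealI)
  have "\<zero> = \<zero> \<otimes> x"
    using x by simp
  then show "\<zero> \<in> {r \<otimes> x | r. r \<in> carrier R}"
    by blast
  show "y \<oplus> z \<in> {r \<otimes> x | r. r \<in> carrier R}"
    if "y \<in> {r \<otimes> x | r. r \<in> carrier R}" "z \<in> {r \<otimes> x | r. r \<in> carrier R}" for y z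
    using that x by (auto simp flip: l_distr)
  show "t \<otimes> y \<in> {r \<otimes> x | r. r \<in> carrier R}"
    if "t \<in> carrier R" "y \<in> {r \<otimes> x | r. r \<in> carrier R}" for t y
    using that x by (auto simp flip: m_assoc)
qed (use x in auto)

text \<open>Zorn's lemma, with properness encoded as avoiding \<open>\<one>\<close>, a form that
  passes directly to unions of chains.\<close>

lemma proper_left_ideal_in_maximal:
  assumes I: "left_ideal I R" and one: "\<one> \<notin> I"
  obtains M where "maximal_left_ideal M R" "I \<subseteq> M"
proof -
  define A where "A = {K. left_ideal K R \<and> I \<subseteq> K \<and> \<one> \<notin> K}"
  have "\<exists>M\<in>A. \<forall>K\<in>A. M \<subseteq> K \<longrightarrow> K = M"
  proof (rule subset_Zorn_nonempty)
    show "A \<noteq> {}"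
      using I one by (auto simp: A_def)
    fix C assume C: "C \<noteq> {}" "subset.chain A C"
    have CA: "left_ideal K R" "I \<subseteq> K" "\<one> \<notin> K" if "K \<in> C" for K
      using C(2) that by (auto simp: A_def subset.chain_def)
    have "left_ideal (\<Union>C) R"
    proof (rule left_idealI)
      show "\<Union>C \<subseteq> carrier R"
        using CA left_idealD(1) by blast
      show "\<zero> \<in> \<Union>C"
        using C(1) CA left_idealD(2) by blast
      show "r \<otimes> x \<in> \<Union>C" if "r \<in> carrier R" "x \<in> \<Union>C" for r x
        using that(2) left_idealD(5)[OF CA(1) that(1)] by blast
      fix x y assume "x \<in> \<Union>C" "y \<in> \<Union>C"
      then obtain K L where "K \<in> C" "L \<in> C" "x \<in> K" "y \<in> L"
        by blast
      moreover have "K \<subseteq> L \<or> L \<subseteq> K"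
        using C(2) \<open>K \<in> C\<close> \<open>L \<in> C\<close> by (auto simp: subset.chain_def)
      ultimately obtain N where "N \<in> C" "x \<in> N" "y \<in> N"
        by blast
      then show "x \<oplus> y \<in> \<Union>C"
        using left_idealD(3)[OF CA(1)] by blast
    qed
    moreover have "I \<subseteq> \<Union>C" "\<one> \<notin> \<Union>C"
      using C(1) CA(2,3) by blast+
    ultimately show "\<Union>C \<in> A"
      by (simp add: A_def)
  qed
  then obtain M where M: "M \<in> A" and max: "\<And>K. K \<in> A \<Longrightarrow> M \<subseteq> K \<Longrightarrow> K = M"
    by blast
  have "K = M \<or> K = carrier R" if "left_ideal K R" "M \<subseteq> K" for K
    using max[of K] that M left_ideal_eq_carrier_iff[of K] by (auto simp: A_def)
  then have "maximal_left_ideal M R"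
    using M one by (auto simp: maximal_left_ideal_def A_def)
  with M that show thesis
    by (auto simp: A_def)
qed

lemma left_ideal_jacobson_radical: "left_ideal (jacobson_radical R) R"
proof (rule left_idealI)
  have D: "left_ideal M R" if "maximal_left_ideal M R" for M
    using that by (simp add: maximal_left_ideal_def)
  show "\<zero> \<in> jacobson_radical R"
    using left_idealD(2)[OF D] by (auto simp: jacobson_radical_def)
  show "x \<oplus> y \<in> jacobson_radical R"
    if "x \<in> jacobson_radical R" "y \<in> jacobson_radical R" for x y
    using left_idealD(3)[OF D] that by (auto simp: jacobson_radical_def)
  show "r \<otimes> x \<in> jacobson_radical R"
    if "r \<in> carrier R" "x \<in> jacobson_radical R" for r x
    using left_idealD(5)[OF D] that by (auto simp: jacobson_radical_def)
qed (auto simp: jacobson_radical_def)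

lemma jacobson_radical_closed: "x \<in> jacobson_radical R \<Longrightarrow> x \<in> carrier R"
  by (simp add: jacobson_radical_def)

text \<open>Otherwise the left ideal generated by \<open>\<one> \<ominus> x\<close> lies in a
  maximal one, which also contains \<open>x\<close> and hence \<open>\<one>\<close>.\<close>

lemma jacobson_radical_left_inverse:
  assumes x: "x \<in> jacobson_radical R"
  shows "\<exists>c\<in>carrier R. c \<otimes> (\<one> \<ominus> x) = \<one>"
proof (rule ccontr)
  assume none: "\<not> ?thesis"
  note xc = jacobson_radical_closed[OF x]
  let ?I = "{r \<otimes> (\<one> \<ominus> x) | r. r \<in> carrier R}"
  have "left_ideal ?I R"
    using xc by (intro left_ideal_principal) simp
  moreover have "\<one> \<notin> ?I"
    using none by fastforce
  ultimately obtain M where M: "maximal_left_ideal M R" "?I \<subseteq> M"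
    using proper_left_ideal_in_maximal by blast
  have ideal: "left_ideal M R"
    using M(1) by (simp add: maximal_left_ideal_def)
  have "\<one> \<otimes> (\<one> \<ominus> x) \<in> M"
    using M(2) by blast
  moreover have "x \<in> M"
    using x M(1) by (simp add: jacobson_radical_def)
  ultimately have "(\<one> \<ominus> x) \<oplus> x \<in> M"
    using left_idealD(3)[OF ideal] xc by simp
  moreover have "(\<one> \<ominus> x) \<oplus> x = \<one>"
    using xc by algebra
  ultimately show False
    using M(1) left_ideal_eq_carrier_iff[OF ideal] by (simp add: maximal_left_ideal_def)
qed

text \<open>If a maximal \<open>M\<close> misses \<open>x\<close>, then M + Rx is the whole ring, so
  some \<open>\<one> \<ominus> r \<otimes> x\<close> lies in \<open>M\<close>; a left inverse of it
  would put \<open>\<one>\<close> into \<open>M\<close>.\<close>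

lemma jacobson_radicalI:
  assumes x: "x \<in> carrier R"
    and inv: "\<And>r. r \<in> carrier R \<Longrightarrow> \<exists>c\<in>carrier R. c \<otimes> (\<one> \<ominus> r \<otimes> x) = \<one>"
  shows "x \<in> jacobson_radical R"
proof (rule ccontr)
  assume "x \<notin> jacobson_radical R"
  then obtain M where M: "maximal_left_ideal M R" "x \<notin> M"
    using x by (auto simp: jacobson_radical_def)
  have ideal: "left_ideal M R"
    using M(1) by (simp add: maximal_left_ideal_def)
  note D = left_idealD[OF ideal]
  let ?I = "{m \<oplus> r \<otimes> x | m r. m \<in> M \<and> r \<in> carrier R}"
  have "M \<subseteq> ?I"
  proof
    fix m assume m: "m \<in> M"
    then have "m = m \<oplus> \<zero> \<otimes> x"
      using D(1) x by auto
    with m show "m \<in> ?I"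
      by blast
  qed
  moreover have "x = \<zero> \<oplus> \<one> \<otimes> x"
    using x by simp
  then have "x \<in> ?I"
    using D(2) by blast
  ultimately have "?I = carrier R"
    using M left_ideal_add_principal[OF ideal x] unfolding maximal_left_ideal_def by blast
  then have "\<one> \<in> ?I"
    by blast
  then obtain m r where m: "m \<in> M" and r: "r \<in> carrier R" and eq: "\<one> = m \<oplus> r \<otimes> x"
    by blast
  have mc: "m \<in> carrier R"
    using m D(1) by blast
  then have "(m \<oplus> r \<otimes> x) \<ominus> r \<otimes> x = m"
    using r x by algebra
  then have "\<one> \<ominus> r \<otimes> x = m"
    using eq by simp
  with inv[OF r] obtain c where "c \<in> carrier R" "c \<otimes> m = \<one>"
    by auto
  then have "\<one> \<in> M"
    using D(5) m by metis
  with M(1) left_ideal_eq_carrier_iff[OF ideal] show False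
    by (simp add: maximal_left_ideal_def)
qed

text \<open>One-sided form of Jacobson's identity (1 - xr)^-1 = 1 + x (1 - rx)^-1 r, suggested by
  the geometric series.\<close>

lemma left_inverse_swap:
  assumes c: "c \<in> carrier R" "x \<in> carrier R" "r \<in> carrier R"
    and eq: "c \<otimes> (\<one> \<ominus> r \<otimes> x) = \<one>"
  shows "(\<one> \<oplus> x \<otimes> c \<otimes> r) \<otimes> (\<one> \<ominus> x \<otimes> r) = \<one>"
proof -
  have "(\<one> \<oplus> x \<otimes> c \<otimes> r) \<otimes> (\<one> \<ominus> x \<otimes> r)
      = (\<one> \<ominus> x \<otimes> r) \<oplus> x \<otimes> (c \<otimes> (\<one> \<ominus> r \<otimes> x)) \<otimes> r"
    using c by (simp add: ring_simprules)
  also have "\<dots> = \<one>"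
    unfolding eq using c by algebra
  finally show ?thesis .
qed

lemma Units_if_left_right_inverse:
  assumes "u \<in> carrier R" "a \<in> carrier R" "b \<in> carrier R" "a \<otimes> u = \<one>" "u \<otimes> b = \<one>"
  shows "u \<in> Units R"
proof -
  have "a = b"
    using assms inv_unique by blast
  with assms show ?thesis
    by (auto simp: Units_def)
qed

lemma ideal_jacobson_radical: "ideal (jacobson_radical R) R"
proof (rule idealI)
  note D = left_idealD[OF left_ideal_jacobson_radical]
  show "ring R"
    by (rule ring_axioms)
  show "subgroup (jacobson_radical R) (add_monoid R)"
    using left_ideal_jacobson_radical additive_subgroup.a_subgroup
    by (auto simp: left_ideal_def)
  fix x r assume x: "x \<in> jacobson_radical R" and r: "r \<in> carrier R"
  show "r \<otimes> x \<in> jacobson_radical R"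
    using D(5) x r by blast
  have xc: "x \<in> carrier R"
    using D(1) x by blast
  show "x \<otimes> r \<in> jacobson_radical R"
  proof (rule jacobson_radicalI)
    fix s assume s: "s \<in> carrier R"
    \<comment> \<open>The factor \<open>r\<close> is rotated to the front, where closure under left
      multiplication applies; \<open>left_inverse_swap\<close> then moves it back behind
      \<open>x\<close>.\<close>
    have "(r \<otimes> s) \<otimes> x \<in> jacobson_radical R"
      using D(5) x r s by simp
    then obtain c where c: "c \<in> carrier R" "c \<otimes> (\<one> \<ominus> r \<otimes> (s \<otimes> x)) = \<one>"
      using jacobson_radical_left_inverse xc r s by (force simp: m_assoc)
    then have "(\<one> \<oplus> s \<otimes> x \<otimes> c \<otimes> r) \<otimes> (\<one> \<ominus> s \<otimes> (x \<otimes> r)) = \<one>"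
      using left_inverse_swap[of c "s \<otimes> x" r] xc r s by (simp add: m_assoc)
    then show "\<exists>c\<in>carrier R. c \<otimes> (\<one> \<ominus> s \<otimes> (x \<otimes> r)) = \<one>"
      using xc r s c by blast
  qed (use xc r in simp)
qed

text \<open>A left inverse \<open>y\<close> equals 1 + yx, which is again 1 minus an element of the
  radical. So \<open>y\<close> has a left inverse too, and having \<open>\<one> \<ominus> x\<close>
  as right inverse it is a unit.\<close>

lemma one_minus_jacobson_radical_Units:
  assumes x: "x \<in> jacobson_radical R"
  shows "\<one> \<ominus> x \<in> Units R"
proof -
  note D = left_idealD[OF left_ideal_jacobson_radical]
  have xc: "x \<in> carrier R"
    using D(1) x by blast
  obtain y where y: "y \<in> carrier R" "y \<otimes> (\<one> \<ominus> x) = \<one>"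
    using jacobson_radical_left_inverse[OF x] by blast
  have "y = y \<otimes> (\<one> \<ominus> x) \<oplus> y \<otimes> x"
    using xc y(1) by (simp add: ring_simprules)
  then have "y = \<one> \<ominus> (\<ominus> (y \<otimes> x))"
    using xc y by (simp add: minus_eq)
  moreover have "\<ominus> (y \<otimes> x) \<in> jacobson_radical R"
    using D(4,5) x y by blast
  ultimately obtain z where "z \<in> carrier R" "z \<otimes> y = \<one>"
    using jacobson_radical_left_inverse by metis
  then have "y \<in> Units R"
    using Units_if_left_right_inverse[of y z "\<one> \<ominus> x"] y xc by simp
  moreover have "inv y = \<one> \<ominus> x"
    using inv_unique[of "inv y" y "\<one> \<ominus> x"] y xc calculation by simp
  ultimately show ?thesis
    using Units_inv_Units by metis
qed

text \<open>A right inverse \<open>c\<close> of 1 - xr equals 1 + xrc, which has the same shape and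
  so is right invertible itself. Hence \<open>c\<close> also inverts 1 - xr from the left, and
  \<open>left_inverse_swap\<close> leads to the left-hand test.\<close>

lemma jacobson_radicalI_right:
  assumes x: "x \<in> carrier R"
    and inv: "\<And>r. r \<in> carrier R \<Longrightarrow> \<exists>c\<in>carrier R. (\<one> \<ominus> x \<otimes> r) \<otimes> c = \<one>"
  shows "x \<in> jacobson_radical R"
proof (rule jacobson_radicalI[OF x])
  fix r assume r: "r \<in> carrier R"
  obtain c where c: "c \<in> carrier R" "(\<one> \<ominus> x \<otimes> r) \<otimes> c = \<one>"
    using inv[OF r] by blast
  have "c = (\<one> \<ominus> x \<otimes> r) \<otimes> c \<oplus> x \<otimes> (r \<otimes> c)"
    using x r c(1) by algebra
  then have "c = \<one> \<ominus> x \<otimes> (\<ominus> (r \<otimes> c))"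
    using x r c by (simp add: minus_eq r_minus)
  moreover have "\<ominus> (r \<otimes> c) \<in> carrier R"
    using r c by simp
  ultimately obtain d where d: "d \<in> carrier R" "c \<otimes> d = \<one>"
    using inv by metis
  have "d = \<one> \<ominus> x \<otimes> r"
    using inv_unique[of "\<one> \<ominus> x \<otimes> r" c d] c d x r by simp
  with d have "c \<otimes> (\<one> \<ominus> x \<otimes> r) = \<one>"
    by simp
  then have "(\<one> \<oplus> r \<otimes> c \<otimes> x) \<otimes> (\<one> \<ominus> r \<otimes> x) = \<one>"
    using left_inverse_swap[of c r x] x r c by simp
  then show "\<exists>c\<in>carrier R. c \<otimes> (\<one> \<ominus> r \<otimes> x) = \<one>"
    using x r c by blast
qed

subsection \<open>The set $\Delta(R)$\<close>

lemma Delta_closed: "d \<in> Delta R \<Longrightarrow> d \<in> carrier R"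
  by (simp add: Delta_def)

lemma minus_Units: "u \<in> Units R \<Longrightarrow> \<ominus> u \<in> Units R"
  using Units_closed[of u]
  by (intro Units_if_left_right_inverse[of _ "\<ominus> (inv u)" "\<ominus> (inv u)"])
    (auto simp: l_minus r_minus)

text \<open>For a unit \<open>u\<close>, factor x + u = u (1 + u^-1 x).\<close>

lemma jacobson_radical_subset_Delta: "jacobson_radical R \<subseteq> Delta R"
proof
  interpret J: ideal "jacobson_radical R" R
    by (rule ideal_jacobson_radical)
  fix x assume x: "x \<in> jacobson_radical R"
  have xc: "x \<in> carrier R"
    using x by (rule jacobson_radical_closed)
  have "x \<oplus> u \<in> Units R" if u: "u \<in> Units R" for u
  proof -
    have uc: "u \<in> carrier R"
      using u by auto
    have "\<ominus> (inv u \<otimes> x) \<in> jacobson_radical R"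
      using u x by (simp add: J.I_l_closed)
    then have "u \<otimes> (\<one> \<ominus> (\<ominus> (inv u \<otimes> x))) \<in> Units R"
      using u one_minus_jacobson_radical_Units by blast
    moreover have "u \<otimes> (\<one> \<ominus> (\<ominus> (inv u \<otimes> x))) = u \<oplus> (u \<otimes> inv u) \<otimes> x"
      using u uc xc by (simp add: minus_eq r_distr m_assoc del: Units_r_inv)
    ultimately show ?thesis
      using u uc xc by (simp add: a_comm)
  qed
  then show "x \<in> Delta R"
    using xc by (simp add: Delta_def)
qed

text \<open>Adding \<open>\<one>\<close> or \<open>\<ominus> \<one>\<close> to an element of
  \<open>Delta\<close> yields a unit by definition, so the content of the set equation is the
  inclusion of the units.\<close>

lemma WDeltaU_iff:
  "WDeltaU R \<longleftrightarrow> (\<forall>u\<in>Units R. u \<ominus> \<one> \<in> Delta R \<or> u \<oplus> \<one> \<in> Delta R)"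
proof -
  have set_add: "{\<one>, \<ominus> \<one>} <+> Delta R = {s \<oplus> d | s d. (s = \<one> \<or> s = \<ominus> \<one>) \<and> d \<in> Delta R}"
    by (auto simp: set_add_def')
  have "{\<one>, \<ominus> \<one>} <+> Delta R \<subseteq> Units R"
    using minus_Units[of \<one>] by (auto simp: set_add) (auto simp: Delta_def a_comm)
  moreover have "u \<in> {\<one>, \<ominus> \<one>} <+> Delta R \<longleftrightarrow> u \<ominus> \<one> \<in> Delta R \<or> u \<oplus> \<one> \<in> Delta R"
    if u: "u \<in> carrier R" for u
  proof -
    have "(\<one> \<oplus> d) \<ominus> \<one> = d" "(\<ominus> \<one> \<oplus> d) \<oplus> \<one> = d" if "d \<in> carrier R" for d
      using that by algebra+
    moreover have "u = \<one> \<oplus> (u \<ominus> \<one>)" "u = \<ominus> \<one> \<oplus> (u \<oplus> \<one>)"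
      using u by algebra+
    ultimately show ?thesis
      unfolding set_add using Delta_closed by (smt (verit) mem_Collect_eq)
  qed
  ultimately show ?thesis
    unfolding WDeltaU_def by blast
qed

subsection \<open>Weakly $\Delta U$ rings with enough idempotents\<close>

lemma one_plus_square_zero_Units:
  assumes "p \<in> carrier R" "p \<otimes> p = \<zero>"
  shows "\<one> \<oplus> p \<in> Units R"
proof (rule Units_if_left_right_inverse[of _ "\<one> \<ominus> p" "\<one> \<ominus> p"])
  have "(\<one> \<ominus> p) \<otimes> (\<one> \<oplus> p) = \<one> \<ominus> p \<otimes> p" "(\<one> \<oplus> p) \<otimes> (\<one> \<ominus> p) = \<one> \<ominus> p \<otimes> p"
    using assms(1) by algebra+
  with assms show "(\<one> \<ominus> p) \<otimes> (\<one> \<oplus> p) = \<one>" "(\<one> \<oplus> p) \<otimes> (\<one> \<ominus> p) = \<one>"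
    by (simp_all add: minus_eq)
qed (use assms in auto)

text \<open>The three relations make $p$ and $q$ matrix units $e_{12}$ and $e_{21}$ on a corner of $R$,
  where $1 + p + q$ becomes the singular matrix with all entries $1$. It is both
  $p + (1 + q)$ and $(2 + p) + (q - 1)$, hence a unit as soon as $p$ or $2 + p$ is in $\Delta(R)$.\<close>

lemma WDeltaU_no_matrix_units:
  assumes W: "WDeltaU R"
    and c: "p \<in> carrier R" "q \<in> carrier R"
    and rel: "p \<otimes> p = \<zero>" "q \<otimes> q = \<zero>" "q \<otimes> p \<otimes> q = q"
  shows "q = \<zero>"
proof -
  have q1: "\<one> \<oplus> q \<in> Units R"
    using c rel by (simp add: one_plus_square_zero_Units)
  have "\<one> \<ominus> q \<in> Units R"
    using one_plus_square_zero_Units[of "\<ominus> q"] c rel by (simp add: minus_eq l_minus r_minus)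
  then have q2: "\<ominus> (\<one> \<ominus> q) \<in> Units R"
    by (rule minus_Units)
  have "\<one> \<oplus> p \<in> Units R"
    using c rel by (simp add: one_plus_square_zero_Units)
  then have "\<one> \<oplus> p \<ominus> \<one> \<in> Delta R \<or> \<one> \<oplus> p \<oplus> \<one> \<in> Delta R"
    using W WDeltaU_iff by blast
  then have "\<one> \<oplus> p \<oplus> q \<in> Units R"
  proof
    assume "\<one> \<oplus> p \<ominus> \<one> \<in> Delta R"
    then have "(\<one> \<oplus> p \<ominus> \<one>) \<oplus> (\<one> \<oplus> q) \<in> Units R"
      using q1 by (simp add: Delta_def)
    moreover have "(\<one> \<oplus> p \<ominus> \<one>) \<oplus> (\<one> \<oplus> q) = \<one> \<oplus> p \<oplus> q"
      using c by algebra
    ultimately show ?thesis by simp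
  next
    assume "\<one> \<oplus> p \<oplus> \<one> \<in> Delta R"
    then have "(\<one> \<oplus> p \<oplus> \<one>) \<oplus> \<ominus> (\<one> \<ominus> q) \<in> Units R"
      using q2 by (simp add: Delta_def)
    moreover have "(\<one> \<oplus> p \<oplus> \<one>) \<oplus> \<ominus> (\<one> \<ominus> q) = \<one> \<oplus> p \<oplus> q"
      using c by algebra
    ultimately show ?thesis by simp
  qed
  \<comment> \<open>With \<open>p \<otimes> q\<close> as e_11 and \<open>q\<close> as e_21, the
    right factor is the column (1, -1), which the all-ones matrix kills.\<close>
  moreover have "(\<one> \<oplus> p \<oplus> q) \<otimes> (p \<otimes> q \<ominus> q) = \<zero>"
  proof -
    have "(\<one> \<oplus> p \<oplus> q) \<otimes> (p \<otimes> q \<ominus> q) = (q \<otimes> p \<otimes> q \<ominus> q) \<oplus> (p \<otimes> p) \<otimes> q \<ominus> q \<otimes> q"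
      using c by algebra
    then show ?thesis
      using rel c by (simp add: minus_eq r_neg)
  qed
  ultimately have "p \<otimes> q \<ominus> q = \<zero>"
    using c Units_l_cancel[of "\<one> \<oplus> p \<oplus> q" "p \<otimes> q \<ominus> q" \<zero>] by (simp add: Units_closed)
  then have "p \<otimes> q = q"
    using c by simp
  then have "q \<otimes> p \<otimes> q = q \<otimes> q"
    using c by (simp add: m_assoc)
  then show ?thesis
    using rel by simp
qed

text \<open>A nonzero square-zero \<open>x\<close> has a nonzero idempotent multiple
  \<open>f = x \<otimes> r\<close>. From \<open>x\<close>, \<open>r\<close> and \<open>f\<close> one
  builds the configuration that \<open>WDeltaU_no_matrix_units\<close> forbids.\<close>

lemma WDeltaU_reduced:
  assumes W: "WDeltaU R"
    and semipotent: "\<And>x. x \<in> carrier R \<Longrightarrow> x \<noteq> \<zero> \<Longrightarrow>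
      \<exists>f. idempotent_elem R f \<and> f \<in> principal_right_ideal R x \<and> f \<noteq> \<zero>"
    and x: "x \<in> carrier R" "x \<otimes> x = \<zero>"
  shows "x = \<zero>"
proof (rule ccontr)
  assume "x \<noteq> \<zero>"
  then obtain r where r: "r \<in> carrier R" and f: "x \<otimes> r \<otimes> (x \<otimes> r) = x \<otimes> r" "x \<otimes> r \<noteq> \<zero>"
    using semipotent[OF x(1)] by (auto simp: idempotent_elem_def principal_right_ideal_def)
  define f where "f = x \<otimes> r"
  define y where "y = r \<otimes> f"
  have c: "f \<in> carrier R" "y \<in> carrier R"
    using x r by (auto simp: f_def y_def)
  have ff: "f \<otimes> f = f"
    using f by (simp add: f_def)
  have xy: "x \<otimes> y = f"
    using f x r by (simp add: f_def y_def m_assoc)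
  have yf: "y \<otimes> f = y"
    using ff c r by (simp add: y_def m_assoc)
  have xf: "x \<otimes> f = \<zero>"
  proof -
    have "x \<otimes> f = x \<otimes> x \<otimes> r"
      using x(1) r by (simp add: f_def m_assoc)
    then show ?thesis
      using x r by simp
  qed
  \<comment> \<open>These are the off-diagonal Peirce components with respect to \<open>f\<close>:
    since xf = 0, \<open>p\<close> is f x (1 - f), and \<open>q\<close> is (1 - f) r f. Their
    product \<open>p \<otimes> q\<close> recovers \<open>f\<close>.\<close>
  define p q where "p = f \<otimes> x" and "q = y \<ominus> f \<otimes> y"
  have pc: "p \<in> carrier R" "q \<in> carrier R"
    using c x by (auto simp: p_def q_def)
  have fq: "f \<otimes> q = \<zero>"
  proof -
    have "f \<otimes> q = f \<otimes> y \<ominus> (f \<otimes> f) \<otimes> y"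
      using c by (simp add: q_def ring_simprules)
    then show ?thesis
      using ff c by (simp add: r_neg minus_eq)
  qed
  have qf: "q \<otimes> f = q"
  proof -
    have "q \<otimes> f = y \<otimes> f \<ominus> f \<otimes> (y \<otimes> f)"
      using c by (simp add: q_def ring_simprules)
    then show ?thesis
      using yf by (simp add: q_def)
  qed
  have pq: "p \<otimes> q = f"
  proof -
    have "p \<otimes> q = f \<otimes> (x \<otimes> y) \<ominus> f \<otimes> (x \<otimes> f) \<otimes> y"
      using c x by (simp add: p_def q_def ring_simprules)
    then show ?thesis
      using xy xf ff c by (simp add: minus_eq)
  qed
  have "p \<otimes> p = f \<otimes> (x \<otimes> f) \<otimes> x"
    using c x by (simp add: p_def m_assoc)
  then have pp: "p \<otimes> p = \<zero>"
    using xf c x by simp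
  have "q \<otimes> q = q \<otimes> (f \<otimes> q)"
    using qf pc c by (simp flip: m_assoc)
  then have qq: "q \<otimes> q = \<zero>"
    using fq pc by simp
  have "q \<otimes> p \<otimes> q = q"
    using pq qf pc by (simp add: m_assoc)
  then have "q = \<zero>"
    using WDeltaU_no_matrix_units[OF W pc pp qq] by simp
  then show False
    using pq pc f by (simp add: f_def)
qed

section \<open>Central idempotents and units in corners\<close>

lemma reduced_idempotent_central:
  assumes reduced: "\<And>x. x \<in> carrier R \<Longrightarrow> x \<otimes> x = \<zero> \<Longrightarrow> x = \<zero>"
    and e: "e \<in> carrier R" "e \<otimes> e = e" and r: "r \<in> carrier R"
  shows "e \<otimes> r = r \<otimes> e"
proof -
  \<comment> \<open>The Peirce components e r (1 - e) and, below, (1 - e) r e square to zero because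
    e (1 - e) = 0; once both vanish, er = ere = re.\<close>
  have "(e \<otimes> r \<ominus> e \<otimes> r \<otimes> e) \<otimes> (e \<otimes> r \<ominus> e \<otimes> r \<otimes> e)
      = e \<otimes> r \<otimes> e \<otimes> r \<ominus> e \<otimes> r \<otimes> e \<otimes> r \<otimes> e \<ominus> e \<otimes> r \<otimes> (e \<otimes> e) \<otimes> r \<oplus> e \<otimes> r \<otimes> (e \<otimes> e) \<otimes> r \<otimes> e"
    using e(1) r by algebra
  also have "\<dots> = \<zero>"
    unfolding e(2) using e(1) r by algebra
  finally have 1: "e \<otimes> r \<ominus> e \<otimes> r \<otimes> e = \<zero>"
    by (rule reduced[rotated]) (use e(1) r in simp)
  have "(r \<otimes> e \<ominus> e \<otimes> r \<otimes> e) \<otimes> (r \<otimes> e \<ominus> e \<otimes> r \<otimes> e)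
      = r \<otimes> e \<otimes> r \<otimes> e \<ominus> r \<otimes> (e \<otimes> e) \<otimes> r \<otimes> e \<ominus> e \<otimes> r \<otimes> e \<otimes> r \<otimes> e \<oplus> e \<otimes> r \<otimes> (e \<otimes> e) \<otimes> r \<otimes> e"
    using e(1) r by algebra
  also have "\<dots> = \<zero>"
    unfolding e(2) using e(1) r by algebra
  finally have 2: "r \<otimes> e \<ominus> e \<otimes> r \<otimes> e = \<zero>"
    by (rule reduced[rotated]) (use e(1) r in simp)
  show ?thesis
    using 1 2 e(1) r by simp
qed

lemma idempotent_complement_Units:
  assumes "idempotent_elem R e" "\<one> \<ominus> e \<in> Units R"
  shows "e = \<zero>"
proof -
  have e: "e \<in> carrier R" "e \<otimes> e = e"
    using assms(1) by (simp_all add: idempotent_elem_def)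
  have "(\<one> \<ominus> e) \<otimes> e = e \<ominus> e \<otimes> e"
    using e(1) by algebra
  then have "(\<one> \<ominus> e) \<otimes> e = (\<one> \<ominus> e) \<otimes> \<zero>"
    using e by simp
  then show ?thesis
    using assms(2) e(1) Units_l_cancel[of "\<one> \<ominus> e" e \<zero>] by blast
qed

text \<open>Dedekind finiteness: \<open>y \<otimes> x\<close> is idempotent, hence central, so yx =
  (yx)(xy) = x(yx)y = (xy)(xy) = 1.\<close>

lemma central_idempotents_right_inverse_Units:
  assumes central: "\<And>e r. idempotent_elem R e \<Longrightarrow> r \<in> carrier R \<Longrightarrow> e \<otimes> r = r \<otimes> e"
    and c: "x \<in> carrier R" "y \<in> carrier R" and xy: "x \<otimes> y = \<one>"
  shows "x \<in> Units R"
proof -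
  have "(y \<otimes> x) \<otimes> (y \<otimes> x) = y \<otimes> (x \<otimes> y) \<otimes> x"
    using c by algebra
  then have "idempotent_elem R (y \<otimes> x)"
    using c xy by (simp add: idempotent_elem_def)
  then have "(y \<otimes> x) \<otimes> x = x \<otimes> (y \<otimes> x)"
    using central c by blast
  then have "((y \<otimes> x) \<otimes> x) \<otimes> y = (x \<otimes> y) \<otimes> (x \<otimes> y)"
    using c by (simp add: m_assoc)
  then have "y \<otimes> x = \<one>"
    using c xy by (simp add: m_assoc)
  then show ?thesis
    using Units_if_left_right_inverse[of x y y] c xy by simp
qed

text \<open>As \<open>e\<close> is central, the ring splits into the corners of \<open>e\<close> and
  1 - e. The element is \<open>a\<close> on the first and the identity on the second;
  \<open>s\<close> gives a right inverse, which Dedekind finiteness makes two-sided.\<close>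

lemma central_idempotents_corner_Units:
  assumes central: "\<And>e r. idempotent_elem R e \<Longrightarrow> r \<in> carrier R \<Longrightarrow> e \<otimes> r = r \<otimes> e"
    and e: "idempotent_elem R e"
    and c: "a \<in> carrier R" "s \<in> carrier R" and as: "a \<otimes> s = e"
  shows "e \<otimes> a \<oplus> (\<one> \<ominus> e) \<in> Units R"
proof -
  define f where "f = \<one> \<ominus> e"
  have ec: "e \<in> carrier R" "e \<otimes> e = e"
    using e by (simp_all add: idempotent_elem_def)
  have fc: "f \<in> carrier R"
    using ec by (simp add: f_def)
  have "e \<otimes> f = e \<ominus> e \<otimes> e" "f \<otimes> e = e \<ominus> e \<otimes> e" "f \<otimes> f = f \<ominus> e \<oplus> e \<otimes> e"
    unfolding f_def using ec(1) by algebra+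
  then have f: "e \<otimes> f = \<zero>" "f \<otimes> e = \<zero>" "f \<otimes> f = f"
    using ec fc by (simp_all add: minus_eq a_assoc r_neg l_neg)
  have sea: "s \<otimes> e = e \<otimes> s" "e \<otimes> a = a \<otimes> e"
    using central[OF e] c by auto
  have "(e \<otimes> a \<oplus> f) \<otimes> (s \<otimes> e \<oplus> f) = e \<otimes> (a \<otimes> s) \<otimes> e \<oplus> (e \<otimes> a) \<otimes> f \<oplus> f \<otimes> (s \<otimes> e) \<oplus> f \<otimes> f"
    using ec(1) fc c by algebra
  also have "\<dots> = e \<otimes> e \<otimes> e \<oplus> a \<otimes> (e \<otimes> f) \<oplus> (f \<otimes> e) \<otimes> s \<oplus> f \<otimes> f"
    unfolding as sea using ec(1) fc c by (simp add: m_assoc)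
  also have "\<dots> = e \<oplus> f"
    using ec f fc c by simp
  also have "\<dots> = \<one>"
    unfolding f_def using ec(1) by algebra
  finally have "(e \<otimes> a \<oplus> f) \<otimes> (s \<otimes> e \<oplus> f) = \<one>" .
  then show ?thesis
    using central_idempotents_right_inverse_Units[OF central, of "e \<otimes> a \<oplus> f" "s \<otimes> e \<oplus> f"] ec fc c
    by (simp add: f_def)
qed

section \<open>The identity a^3 = a and its consequences\<close>

lemma cube_idempotent_Units:
  assumes a: "a \<in> carrier R" and cube: "a \<otimes> a \<otimes> a = a"
  shows "a \<oplus> (\<one> \<ominus> a \<otimes> a) \<in> Units R"
proof -
  \<comment> \<open>The element is its own inverse: a (1 - a^2) = 0 removes the mixed terms, and a^2
    + (1 - a^2)^2 = 1 because a^2 is idempotent.\<close>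
  have "(a \<oplus> (\<one> \<ominus> a \<otimes> a)) \<otimes> (a \<oplus> (\<one> \<ominus> a \<otimes> a))
      = \<one> \<oplus> (a \<oplus> a) \<ominus> (a \<otimes> a \<otimes> a \<oplus> a \<otimes> a \<otimes> a) \<ominus> a \<otimes> a \<oplus> (a \<otimes> a \<otimes> a) \<otimes> a"
    using a by algebra
  also have "\<dots> = \<one>"
    unfolding cube using a by algebra
  finally show ?thesis
    using a Units_if_left_right_inverse by (metis a_closed m_closed minus_closed one_closed)
qed

text \<open>Otherwise a nonzero central idempotent $e$ lies in $(a - a^3)R$, so that $a$, $1 - a$ and $1 + a$
  are all invertible in the corner $eR$. Hence $u = ea + (1 - e)$ is a unit, but neither $u - 1$ nor
  $u + 1$ is in $\Delta(R)$, since each differs by a unit from the non-unit $1 - e$.\<close>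

lemma WDeltaU_semipotent_cube:
  assumes W: "WDeltaU R"
    and semipotent: "\<And>x. x \<in> carrier R \<Longrightarrow> x \<noteq> \<zero> \<Longrightarrow>
      \<exists>f. idempotent_elem R f \<and> f \<in> principal_right_ideal R x \<and> f \<noteq> \<zero>"
    and a: "a \<in> carrier R"
  shows "a \<otimes> a \<otimes> a = a"
proof (rule ccontr)
  assume "a \<otimes> a \<otimes> a \<noteq> a"
  then have "a \<ominus> a \<otimes> a \<otimes> a \<noteq> \<zero>"
    using a by auto
  then obtain e r where e: "idempotent_elem R e" "e \<noteq> \<zero>"
    and r: "r \<in> carrier R" and er: "e = (a \<ominus> a \<otimes> a \<otimes> a) \<otimes> r"
    using semipotent[of "a \<ominus> a \<otimes> a \<otimes> a"] a by (auto simp: principal_right_ideal_def)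
  have ec: "e \<in> carrier R"
    using e(1) by (simp add: idempotent_elem_def)
  have central: "f \<otimes> s = s \<otimes> f" if "idempotent_elem R f" "s \<in> carrier R" for f s
  proof (rule reduced_idempotent_central)
    show "x = \<zero>" if "x \<in> carrier R" "x \<otimes> x = \<zero>" for x
      using WDeltaU_reduced[OF W semipotent that] .
  qed (use that in \<open>simp_all add: idempotent_elem_def\<close>)
  note corner = central_idempotents_corner_Units[OF central e(1)]
  \<comment> \<open>The polynomial a - a^3 is the product of the commuting factors a, 1 - a and 1 +
    a. Pulling one of them to the front of \<open>e\<close> leaves the other two times
    \<open>r\<close> as its right inverse in the corner; the two units below arise likewise.\<close>
  have "e \<otimes> a \<oplus> (\<one> \<ominus> e) \<in> Units R"
    by (rule corner[of _ "(\<one> \<ominus> a) \<otimes> (\<one> \<oplus> a) \<otimes> r"])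
      (use a r in \<open>simp_all add: er\<close>, algebra)
  then have "e \<otimes> a \<oplus> (\<one> \<ominus> e) \<ominus> \<one> \<in> Delta R \<or> e \<otimes> a \<oplus> (\<one> \<ominus> e) \<oplus> \<one> \<in> Delta R"
    using W WDeltaU_iff by blast
  then have "\<one> \<ominus> e \<in> Units R"
  proof
    assume d: "e \<otimes> a \<oplus> (\<one> \<ominus> e) \<ominus> \<one> \<in> Delta R"
    have "e \<otimes> (\<one> \<ominus> a) \<oplus> (\<one> \<ominus> e) \<in> Units R"
      by (rule corner[of _ "a \<otimes> (\<one> \<oplus> a) \<otimes> r"])
        (use a r in \<open>simp_all add: er\<close>, algebra)
    with d have "(e \<otimes> a \<oplus> (\<one> \<ominus> e) \<ominus> \<one>) \<oplus> (e \<otimes> (\<one> \<ominus> a) \<oplus> (\<one> \<ominus> e)) \<in> Units R"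
      by (simp add: Delta_def)
    moreover have "(e \<otimes> a \<oplus> (\<one> \<ominus> e) \<ominus> \<one>) \<oplus> (e \<otimes> (\<one> \<ominus> a) \<oplus> (\<one> \<ominus> e)) = \<one> \<ominus> e"
      using a ec by algebra
    ultimately show ?thesis by simp
  next
    assume d: "e \<otimes> a \<oplus> (\<one> \<ominus> e) \<oplus> \<one> \<in> Delta R"
    have "e \<otimes> (\<one> \<oplus> a) \<oplus> (\<one> \<ominus> e) \<in> Units R"
      by (rule corner[of _ "a \<otimes> (\<one> \<ominus> a) \<otimes> r"])
        (use a r in \<open>simp_all add: er\<close>, algebra)
    then have "\<ominus> (e \<otimes> (\<one> \<oplus> a) \<oplus> (\<one> \<ominus> e)) \<in> Units R"
      by (rule minus_Units)
    with d have "(e \<otimes> a \<oplus> (\<one> \<ominus> e) \<oplus> \<one>) \<oplus> \<ominus> (e \<otimes> (\<one> \<oplus> a) \<oplus> (\<one> \<ominus> e)) \<in> Units R"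
      by (simp add: Delta_def)
    moreover have "(e \<otimes> a \<oplus> (\<one> \<ominus> e) \<oplus> \<one>) \<oplus> \<ominus> (e \<otimes> (\<one> \<oplus> a) \<oplus> (\<one> \<ominus> e)) = \<one> \<ominus> e"
      using a ec by algebra
    ultimately show ?thesis by simp
  qed
  then show False
    using idempotent_complement_Units e by blast
qed

text \<open>Adding \<open>d\<close> to the unit that \<open>cube_idempotent_Units\<close> attaches
  to -d leaves 1 - d^2. This is a unit and the complement of an idempotent, so d^2 = 0 and d = d^3 =
  0.\<close>

lemma cube_Delta_eq_zero:
  assumes cube: "\<And>a. a \<in> carrier R \<Longrightarrow> a \<otimes> a \<otimes> a = a"
    and d: "d \<in> Delta R"
  shows "d = \<zero>"
proof -
  have dc: "d \<in> carrier R"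
    using d by (rule Delta_closed)
  have "\<ominus> d \<oplus> (\<one> \<ominus> \<ominus> d \<otimes> \<ominus> d) \<in> Units R"
    using dc cube by (intro cube_idempotent_Units) auto
  then have "d \<oplus> (\<ominus> d \<oplus> (\<one> \<ominus> \<ominus> d \<otimes> \<ominus> d)) \<in> Units R"
    using d by (simp add: Delta_def)
  moreover have "d \<oplus> (\<ominus> d \<oplus> (\<one> \<ominus> \<ominus> d \<otimes> \<ominus> d)) = \<one> \<ominus> d \<otimes> d"
    using dc by algebra
  ultimately have "\<one> \<ominus> d \<otimes> d \<in> Units R"
    by simp
  moreover have "idempotent_elem R (d \<otimes> d)"
    using dc cube[OF dc] by (simp add: idempotent_elem_def flip: m_assoc)
  ultimately have "d \<otimes> d = \<zero>"
    using idempotent_complement_Units by blast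
  then show ?thesis
    using cube[OF dc] dc by simp
qed

lemma WDeltaU_semipotent_weakly_boolean:
  assumes W: "WDeltaU R"
    and semipotent: "\<And>x. x \<in> carrier R \<Longrightarrow> x \<noteq> \<zero> \<Longrightarrow>
      \<exists>f. idempotent_elem R f \<and> f \<in> principal_right_ideal R x \<and> f \<noteq> \<zero>"
  shows "weakly_boolean R"
  unfolding weakly_boolean_def
proof
  fix a assume a: "a \<in> carrier R"
  have cube: "b \<otimes> b \<otimes> b = b" if "b \<in> carrier R" for b
    using WDeltaU_semipotent_cube[OF W semipotent that] .
  let ?u = "a \<oplus> (\<one> \<ominus> a \<otimes> a)"
  have "?u \<ominus> \<one> \<in> Delta R \<or> ?u \<oplus> \<one> \<in> Delta R"
    using W WDeltaU_iff cube_idempotent_Units[OF a cube[OF a]] by blast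
  then have "?u \<ominus> \<one> = \<zero> \<or> ?u \<oplus> \<one> = \<zero>"
    using cube_Delta_eq_zero[OF cube] by blast
  then show "idempotent_elem R a \<or> idempotent_elem R (\<ominus> a)"
  proof
    assume "?u \<ominus> \<one> = \<zero>"
    moreover have "?u \<ominus> \<one> = a \<ominus> a \<otimes> a"
      using a by algebra
    ultimately show ?thesis
      using a by (simp add: idempotent_elem_def)
  next
    assume u: "?u \<oplus> \<one> = \<zero>"
    \<comment> \<open>The hypothesis reads a + 2 - a^2 = 0. Multiplying by a^2 and reducing with a^3
      = a turns the constant 2 into 2 a^2, leaving a + a^2 = 0.\<close>
    have "a \<otimes> a \<otimes> (?u \<oplus> \<one>) = a \<otimes> a \<otimes> a \<oplus> a \<otimes> a \<oplus> a \<otimes> a \<ominus> (a \<otimes> a \<otimes> a) \<otimes> a"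
      using a by algebra
    also have "\<dots> = a \<otimes> a \<ominus> \<ominus> a"
      unfolding cube[OF a] using a by algebra
    finally have "a \<otimes> a \<ominus> \<ominus> a = \<zero>"
      unfolding u using a by simp
    then show ?thesis
      using a by (simp add: idempotent_elem_def l_minus r_minus)
  qed
qed

lemma weakly_boolean_von_neumann_regular:
  assumes "weakly_boolean R"
  shows "von_neumann_regular R"
  unfolding von_neumann_regular_def
proof
  fix a assume a: "a \<in> carrier R"
  from assms a consider "a \<otimes> a = a" | "\<ominus> a \<otimes> \<ominus> a = \<ominus> a"
    by (auto simp: weakly_boolean_def idempotent_elem_def)
  then show "\<exists>x\<in>carrier R. a \<otimes> x \<otimes> a = a"
  proof cases
    case 1
    then have "a \<otimes> \<one> \<otimes> a = a"
      using a by simp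
    then show ?thesis
      by blast
  next
    case 2
    then have "a \<otimes> \<ominus> \<one> \<otimes> a = a"
      using a by (simp add: l_minus r_minus)
    then show ?thesis
      by blast
  qed
qed

subsection \<open>Passing to the quotient by the Jacobson radical\<close>

lemma quotient_jacobson_radical_simps:
  defines "J \<equiv> jacobson_radical R"
  shows "carrier (R Quot J) = {J +> x | x. x \<in> carrier R}"
    and "\<one>\<^bsub>R Quot J\<^esub> = J +> \<one>"
    and "\<zero>\<^bsub>R Quot J\<^esub> = J +> \<zero>"
    and "\<And>x y. x \<in> carrier R \<Longrightarrow> y \<in> carrier R \<Longrightarrow> (J +> x) \<oplus>\<^bsub>R Quot J\<^esub> (J +> y) = J +> (x \<oplus> y)"
    and "\<And>x y. x \<in> carrier R \<Longrightarrow> y \<in> carrier R \<Longrightarrow> (J +> x) \<otimes>\<^bsub>R Quot J\<^esub> (J +> y) = J +> (x \<otimes> y)"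
    and "\<And>x. x \<in> carrier R \<Longrightarrow> \<ominus>\<^bsub>R Quot J\<^esub> (J +> x) = J +> (\<ominus> x)"
    and "\<And>x y. x \<in> carrier R \<Longrightarrow> y \<in> carrier R \<Longrightarrow> (J +> x) \<ominus>\<^bsub>R Quot J\<^esub> (J +> y) = J +> (x \<ominus> y)"
    and "\<And>x y. x \<in> carrier R \<Longrightarrow> y \<in> carrier R \<Longrightarrow> J +> x = J +> y \<longleftrightarrow> x \<ominus> y \<in> J"
proof -
  interpret J: ideal J R
    unfolding J_def by (rule ideal_jacobson_radical)
  interpret h: ring_hom_ring R "R Quot J" "(+>) J"
    by (rule J.rcos_ring_hom_ring)
  show "carrier (R Quot J) = {J +> x | x. x \<in> carrier R}"
    unfolding FactRing_def A_RCOSETS_def' by auto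
  show "\<one>\<^bsub>R Quot J\<^esub> = J +> \<one>" "\<zero>\<^bsub>R Quot J\<^esub> = J +> \<zero>"
    by (simp_all only: h.hom_one h.hom_zero)
  fix x assume x: "x \<in> carrier R"
  show minus: "\<ominus>\<^bsub>R Quot J\<^esub> (J +> x) = J +> (\<ominus> x)"
    using x by simp
  fix y assume y: "y \<in> carrier R"
  show "(J +> x) \<oplus>\<^bsub>R Quot J\<^esub> (J +> y) = J +> (x \<oplus> y)"
    "(J +> x) \<otimes>\<^bsub>R Quot J\<^esub> (J +> y) = J +> (x \<otimes> y)"
    using x y by simp_all
  show "(J +> x) \<ominus>\<^bsub>R Quot J\<^esub> (J +> y) = J +> (x \<ominus> y)"
    using x y by (simp add: a_minus_def)
  show "J +> x = J +> y \<longleftrightarrow> x \<ominus> y \<in> J"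
    using quotient_eq_iff_same_a_r_cos[OF J.ideal_axioms x y] by simp
qed

lemma idempotent_quotient_jacobson_radical_iff:
  assumes "a \<in> carrier R"
  shows "idempotent_elem (R Quot jacobson_radical R) (jacobson_radical R +> a)
    \<longleftrightarrow> a \<otimes> a \<ominus> a \<in> jacobson_radical R"
  using assms by (auto simp: idempotent_elem_def quotient_jacobson_radical_simps)

text \<open>If \<open>v\<close> inverts \<open>u\<close> modulo the radical, then
  \<open>v \<otimes> u\<close> and \<open>u \<otimes> v\<close> lie in 1 + J(R) and are units; they
  supply a left and a right inverse of \<open>u\<close>.\<close>

lemma Units_quotient_jacobson_radical_iff:
  assumes u: "u \<in> carrier R"
  shows "jacobson_radical R +> u \<in> Units (R Quot jacobson_radical R) \<longleftrightarrow> u \<in> Units R"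
proof
  assume "jacobson_radical R +> u \<in> Units (R Quot jacobson_radical R)"
  then obtain v where v: "v \<in> carrier R"
    and J: "v \<otimes> u \<ominus> \<one> \<in> jacobson_radical R" "u \<otimes> v \<ominus> \<one> \<in> jacobson_radical R"
    using u by (auto simp: Units_def quotient_jacobson_radical_simps)
  have unit: "w \<in> Units R" if "w \<in> carrier R" "w \<ominus> \<one> \<in> jacobson_radical R" for w
  proof -
    have "w \<ominus> \<one> \<oplus> \<one> \<in> Units R"
      using jacobson_radical_subset_Delta that by (auto simp: Delta_def)
    moreover have "w \<ominus> \<one> \<oplus> \<one> = w"
      using that by algebra
    ultimately show ?thesis by simp
  qed
  have vu: "v \<otimes> u \<in> Units R" and uv: "u \<otimes> v \<in> Units R"
    using unit J u v by auto
  show "u \<in> Units R"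
  proof (rule Units_if_left_right_inverse)
    show "inv (v \<otimes> u) \<otimes> v \<otimes> u = \<one>"
      using vu u v by (simp add: m_assoc)
    show "u \<otimes> (v \<otimes> inv (u \<otimes> v)) = \<one>"
      using uv u v by (simp flip: m_assoc)
  qed (use u v vu uv in auto)
next
  assume "u \<in> Units R"
  then obtain v where "v \<in> carrier R" "v \<otimes> u = \<one>" "u \<otimes> v = \<one>"
    by (auto simp: Units_def)
  then show "jacobson_radical R +> u \<in> Units (R Quot jacobson_radical R)"
    using u by (force simp: Units_def quotient_jacobson_radical_simps(1,2,5))
qed

text \<open>Units of the quotient are exactly the cosets of units, so \<open>Delta\<close> maps into
  \<open>Delta\<close>, and the sign that suits \<open>u\<close> suits its coset.\<close>

lemma WDeltaU_quotient_jacobson_radical: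
  assumes W: "WDeltaU R"
  shows "WDeltaU (R Quot jacobson_radical R)"
proof -
  let ?J = "jacobson_radical R"
  let ?Q = "R Quot jacobson_radical R"
  interpret Q: ring ?Q
    by (rule ideal.quotient_is_ring[OF ideal_jacobson_radical])
  note simps = quotient_jacobson_radical_simps
  have Delta: "?J +> d \<in> Delta ?Q" if d: "d \<in> Delta R" for d
  proof -
    have dc: "d \<in> carrier R"
      using d by (rule Delta_closed)
    have "(?J +> d) \<oplus>\<^bsub>?Q\<^esub> U \<in> Units ?Q" if U: "U \<in> Units ?Q" for U
    proof -
      obtain u where u: "u \<in> carrier R" "U = ?J +> u"
        using Q.Units_closed[OF U] by (auto simp: simps)
      then have "d \<oplus> u \<in> Units R"
        using U d by (auto simp: Units_quotient_jacobson_radical_iff Delta_def)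
      then show ?thesis
        using u dc by (simp add: simps Units_quotient_jacobson_radical_iff)
    qed
    then show ?thesis
      using dc by (auto simp: Delta_def simps(1))
  qed
  show ?thesis
    unfolding Q.WDeltaU_iff
  proof
    fix U assume U: "U \<in> Units ?Q"
    obtain u where u: "u \<in> carrier R" "U = ?J +> u"
      using Q.Units_closed[OF U] by (auto simp: simps)
    then have "u \<in> Units R"
      using U by (simp add: Units_quotient_jacobson_radical_iff)
    then have "u \<ominus> \<one> \<in> Delta R \<or> u \<oplus> \<one> \<in> Delta R"
      using W WDeltaU_iff by blast
    then show "U \<ominus>\<^bsub>?Q\<^esub> \<one>\<^bsub>?Q\<^esub> \<in> Delta ?Q \<or> U \<oplus>\<^bsub>?Q\<^esub> \<one>\<^bsub>?Q\<^esub> \<in> Delta ?Q"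
      using Delta u by (auto simp: simps)
  qed
qed

section \<open>Idempotents supplied by the exchange property\<close>

lemma exchange_idempotents_lift:
  assumes exchange: "exchange_ring R"
  shows "idempotents_lift_modulo R (jacobson_radical R)"
  unfolding idempotents_lift_modulo_def
proof (intro allI impI)
  interpret J: ideal "jacobson_radical R" R
    by (rule ideal_jacobson_radical)
  fix F assume F: "idempotent_elem (R Quot jacobson_radical R) F"
  then obtain a where a: "a \<in> carrier R" "F = jacobson_radical R +> a"
    by (auto simp: idempotent_elem_def quotient_jacobson_radical_simps(1))
  have aJ: "a \<otimes> a \<ominus> a \<in> jacobson_radical R"
    using F a by (simp add: idempotent_quotient_jacobson_radical_iff)
  obtain r s where e: "idempotent_elem R (a \<otimes> r)" and r: "r \<in> carrier R"
    and s: "s \<in> carrier R" "\<one> \<ominus> a \<otimes> r = (\<one> \<ominus> a) \<otimes> s"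
    using exchange a(1) unfolding exchange_ring_def principal_right_ideal_def by blast
  \<comment> \<open>With e = ar one has e - a = (1 - a) e - a (1 - e). Both terms are right
    multiples of a - a^2, since e is in aR and 1 - e in (1 - a)R.\<close>
  have "a \<otimes> r \<ominus> a = \<ominus> ((a \<otimes> a \<ominus> a) \<otimes> r) \<ominus> a \<otimes> (\<one> \<ominus> a \<otimes> r)"
    using a r by algebra
  also have "\<dots> = (a \<otimes> a \<ominus> a) \<otimes> (s \<ominus> r)"
    unfolding s(2) using a r s(1) by algebra
  also have "\<dots> \<in> jacobson_radical R"
    using aJ r s(1) by (intro J.I_r_closed) auto
  finally have "jacobson_radical R +> (a \<otimes> r) = F"
    using a r by (simp add: quotient_jacobson_radical_simps)
  with e show "\<exists>e. idempotent_elem R e \<and> jacobson_radical R +> e = F"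
    by blast
qed

text \<open>If zero were the only idempotent in xR, exchange applied to xr would give 1 = (1 - xr) s
  for every \<open>r\<close>, which is the right-hand test for the radical.\<close>

lemma exchange_semipotent:
  assumes exchange: "exchange_ring R"
    and x: "x \<in> carrier R" "x \<notin> jacobson_radical R"
  shows "\<exists>f. idempotent_elem R f \<and> f \<in> principal_right_ideal R x \<and> f \<noteq> \<zero>"
proof (rule ccontr)
  assume none: "\<not> ?thesis"
  have "x \<in> jacobson_radical R"
  proof (rule jacobson_radicalI_right[OF x(1)])
    fix r assume r: "r \<in> carrier R"
    obtain y s where e: "idempotent_elem R (x \<otimes> r \<otimes> y)" and y: "y \<in> carrier R"
      and s: "s \<in> carrier R" "\<one> \<ominus> x \<otimes> r \<otimes> y = (\<one> \<ominus> x \<otimes> r) \<otimes> s"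
      using exchange m_closed[OF x(1) r] unfolding exchange_ring_def principal_right_ideal_def
      by blast
    have "x \<otimes> r \<otimes> y \<in> principal_right_ideal R x"
      using x(1) r y by (auto simp: principal_right_ideal_def m_assoc)
    then have "x \<otimes> r \<otimes> y = \<zero>"
      using none e by blast
    then have "(\<one> \<ominus> x \<otimes> r) \<otimes> s = \<one>"
      using s by (simp add: minus_eq)
    then show "\<exists>c\<in>carrier R. (\<one> \<ominus> x \<otimes> r) \<otimes> c = \<one>"
      using s(1) by blast
  qed
  with x(2) show False
    by simp
qed

lemma exchange_quotient_semipotent:
  assumes exchange: "exchange_ring R"
    and Y: "Y \<in> carrier (R Quot jacobson_radical R)" "Y \<noteq> \<zero>\<^bsub>R Quot jacobson_radical R\<^esub>"
  shows "\<exists>F. idempotent_elem (R Quot jacobson_radical R) F \<and>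
    F \<in> principal_right_ideal (R Quot jacobson_radical R) Y \<and> F \<noteq> \<zero>\<^bsub>R Quot jacobson_radical R\<^esub>"
proof -
  note simps = quotient_jacobson_radical_simps
  have minus_zero: "y \<ominus> \<zero> = y" if "y \<in> carrier R" for y
    using that by algebra
  obtain x where x: "x \<in> carrier R" "Y = jacobson_radical R +> x"
    using Y(1) by (auto simp: simps)
  then have "x \<notin> jacobson_radical R"
    using Y(2) by (auto simp: simps minus_zero)
  then obtain f r where f: "idempotent_elem R f" "f \<noteq> \<zero>" and r: "r \<in> carrier R" "f = x \<otimes> r"
    using exchange_semipotent[OF exchange x(1)] by (auto simp: principal_right_ideal_def)
  have fc: "f \<in> carrier R" "f \<otimes> f = f"
    using f(1) by (simp_all add: idempotent_elem_def)
  \<comment> \<open>Otherwise 1 - f would be a unit, forcing f = 0; so the idempotent survives in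
    the quotient.\<close>
  have "f \<notin> jacobson_radical R"
    using idempotent_complement_Units[OF f(1)] f(2) one_minus_jacobson_radical_Units by blast
  then have "jacobson_radical R +> f \<noteq> \<zero>\<^bsub>R Quot jacobson_radical R\<^esub>"
    using fc by (simp add: simps minus_zero)
  moreover have "idempotent_elem (R Quot jacobson_radical R) (jacobson_radical R +> f)"
    using fc by (auto simp: idempotent_elem_def simps(1,5))
  moreover have "jacobson_radical R +> f \<in> principal_right_ideal (R Quot jacobson_radical R) Y"
    using x r by (auto simp: principal_right_ideal_def simps(1) simps(5)[symmetric])
  ultimately show ?thesis
    by blast
qed

section \<open>Implications between the three classes\<close>

lemma exchange_WDeltaU_imp_semi_weakly_boolean:
  assumes "exchange_ring R" "WDeltaU R"
  shows "semi_weakly_boolean R"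
proof -
  interpret Q: ring "R Quot jacobson_radical R"
    by (rule ideal.quotient_is_ring[OF ideal_jacobson_radical])
  have "weakly_boolean (R Quot jacobson_radical R)"
    using Q.WDeltaU_semipotent_weakly_boolean[OF WDeltaU_quotient_jacobson_radical[OF assms(2)]]
      exchange_quotient_semipotent[OF assms(1)] by blast
  then show ?thesis
    using exchange_idempotents_lift[OF assms(1)] by (simp add: semi_weakly_boolean_def)
qed

lemma semi_weakly_boolean_imp_semi_regular:
  assumes "semi_weakly_boolean R"
  shows "semi_regular R"
proof -
  interpret Q: ring "R Quot jacobson_radical R"
    by (rule ideal.quotient_is_ring[OF ideal_jacobson_radical])
  show ?thesis
    using assms Q.weakly_boolean_von_neumann_regular
    by (simp add: semi_weakly_boolean_def semi_regular_def)
qed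

lemma semi_weakly_boolean_imp_WDeltaU:
  assumes "semi_weakly_boolean R"
  shows "WDeltaU R"
  unfolding WDeltaU_iff
proof
  interpret J: ideal "jacobson_radical R" R
    by (rule ideal_jacobson_radical)
  fix u assume u: "u \<in> Units R"
  have uc: "u \<in> carrier R"
    using u by auto
  have "idempotent_elem (R Quot jacobson_radical R) (jacobson_radical R +> u)
      \<or> idempotent_elem (R Quot jacobson_radical R) (jacobson_radical R +> (\<ominus> u))"
    using assms uc unfolding semi_weakly_boolean_def weakly_boolean_def
    by (auto simp: quotient_jacobson_radical_simps(1,6))
  then have "u \<otimes> u \<ominus> u \<in> jacobson_radical R \<or> \<ominus> u \<otimes> \<ominus> u \<ominus> \<ominus> u \<in> jacobson_radical R"
    using uc by (simp only: idempotent_quotient_jacobson_radical_iff a_inv_closed)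
  \<comment> \<open>Cancelling one factor \<open>u\<close> leaves u - 1 or u + 1 in the radical,
    hence in \<open>Delta\<close>.\<close>
  then have "inv u \<otimes> (u \<otimes> u \<ominus> u) \<in> jacobson_radical R
      \<or> inv u \<otimes> (\<ominus> u \<otimes> \<ominus> u \<ominus> \<ominus> u) \<in> jacobson_radical R"
    using J.I_l_closed u by blast
  moreover have "inv u \<otimes> (u \<otimes> u \<ominus> u) = (inv u \<otimes> u) \<otimes> u \<ominus> inv u \<otimes> u"
    "inv u \<otimes> (\<ominus> u \<otimes> \<ominus> u \<ominus> \<ominus> u) = (inv u \<otimes> u) \<otimes> u \<oplus> inv u \<otimes> u"
    using Units_inv_closed[OF u] uc by algebra+
  ultimately show "u \<ominus> \<one> \<in> Delta R \<or> u \<oplus> \<one> \<in> Delta R"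
    using jacobson_radical_subset_Delta u uc by auto
qed

text \<open>If $\bar a = \bar a \bar x \bar a$ and $f = ax$, then $1 - (1 - a)(1 - f)$ lies in $aR$ and is
  idempotent modulo $J(R)$. Conjugating a lift of it by a unit in $1 + J(R)$ gives an idempotent $e_2$
  in $aR$ with $w = e_2 + (1 - a)t$ a unit, and $e = e_2 + e_2 w^{-1} (1 - e_2)$ is then idempotent
  with $1 - e = (1 - a) t w^{-1} (1 - e_2)$.\<close>

lemma semi_regular_imp_exchange:
  assumes "semi_regular R"
  shows "exchange_ring R"
  unfolding exchange_ring_def
proof
  let ?J = "jacobson_radical R"
  interpret J: ideal ?J R
    by (rule ideal_jacobson_radical)
  note simps = quotient_jacobson_radical_simps
  fix a assume a: "a \<in> carrier R"
  obtain x where x: "x \<in> carrier R" and k: "a \<otimes> x \<otimes> a \<ominus> a \<in> ?J"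
    using assms a by (auto simp: semi_regular_def von_neumann_regular_def simps)
  \<comment> \<open>Expanding 1 - (1 - a)(1 - ax) gives a (1 + x - ax), which is where
    \<open>s\<close> comes from.\<close>
  define s t where "s = x \<oplus> \<one> \<ominus> a \<otimes> x" and "t = \<one> \<ominus> a \<otimes> x"
  define e0 where "e0 = a \<otimes> s"
  have c: "s \<in> carrier R" "t \<in> carrier R" "e0 \<in> carrier R"
    using a x by (auto simp: s_def t_def e0_def)
  have e0: "\<one> \<ominus> e0 = (\<one> \<ominus> a) \<otimes> t"
    unfolding e0_def s_def t_def using a x by algebra
  have ta: "\<ominus> (t \<otimes> a) = a \<otimes> x \<otimes> a \<ominus> a"
    unfolding t_def using a x by algebra
  have "e0 \<otimes> e0 \<ominus> e0 = \<ominus> ((\<one> \<ominus> e0) \<otimes> e0)"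
    using c(3) by algebra
  also have "\<dots> = (\<one> \<ominus> a) \<otimes> (\<ominus> (t \<otimes> a)) \<otimes> s"
    unfolding e0 using a c by (simp add: e0_def m_assoc l_minus r_minus)
  also have "\<dots> = (\<one> \<ominus> a) \<otimes> (a \<otimes> x \<otimes> a \<ominus> a) \<otimes> s"
    unfolding ta ..
  also have "\<dots> \<in> ?J"
    using k a c by (intro J.I_r_closed J.I_l_closed) auto
  finally obtain e1 where e1: "idempotent_elem R e1" "?J +> e1 = ?J +> e0"
    using assms c unfolding semi_regular_def idempotents_lift_modulo_def
    by (auto simp flip: idempotent_quotient_jacobson_radical_iff)
  have e1c: "e1 \<in> carrier R" "e1 \<otimes> e1 = e1"
    using e1(1) by (simp_all add: idempotent_elem_def)
  define j where "j = e1 \<ominus> e0"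
  have j: "j \<in> ?J" "j \<in> carrier R"
    using e1 e1c c by (simp_all add: j_def simps)
  \<comment> \<open>Since \<open>u\<close> is 1 - e1 + e0, multiplying by \<open>e1\<close> leaves
    only \<open>e0 \<otimes> e1\<close>. The conjugate of \<open>e1\<close> by \<open>u\<close>
    therefore starts with \<open>e0\<close>, and so with \<open>a\<close>.\<close>
  define u where "u = \<one> \<ominus> j"
  have u: "u \<in> Units R" "u \<in> carrier R"
    using one_minus_jacobson_radical_Units[OF j(1)] by (auto simp: u_def)
  have e0_e1: "e0 \<otimes> e1 = u \<otimes> e1"
  proof -
    have "u \<otimes> e1 = e1 \<ominus> e1 \<otimes> e1 \<oplus> e0 \<otimes> e1"
      unfolding u_def j_def using c(3) e1c(1) by algebra
    then show ?thesis
      using e1c c by simp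
  qed
  define e2 where "e2 = u \<otimes> e1 \<otimes> inv u"
  have e2c: "e2 \<in> carrier R"
    using u e1c by (simp add: e2_def)
  have e2_idem: "e2 \<otimes> e2 = e2"
  proof -
    have "e2 \<otimes> e2 = u \<otimes> e1 \<otimes> (inv u \<otimes> u) \<otimes> e1 \<otimes> inv u"
      unfolding e2_def using Units_inv_closed[OF u(1)] u(2) e1c(1) by algebra
    also have "\<dots> = u \<otimes> (e1 \<otimes> e1) \<otimes> inv u"
      using u e1c(1) by (simp add: m_assoc)
    finally show ?thesis
      using e1c by (simp add: e2_def)
  qed
  have e2_a: "e2 = a \<otimes> (s \<otimes> e1 \<otimes> inv u)"
    using e0_e1[symmetric] a c u e1c by (simp add: e2_def e0_def m_assoc)
  have e2u: "e2 \<otimes> u = u \<otimes> e1"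
    using u e1c by (simp add: e2_def m_assoc)
  \<comment> \<open>Modulo the radical \<open>u\<close> is 1, so e2, e1 and e0 agree there.
    Splitting \<open>e2\<close> as e2 u + e2 j shows this without handling the inverse of
    \<open>u\<close>.\<close>
  define i where "i = e2 \<ominus> e0"
  have "i = e2 \<otimes> u \<oplus> e2 \<otimes> j \<ominus> e0"
    unfolding i_def u_def using e2c j c by algebra
  also have "\<dots> = (\<one> \<ominus> j) \<otimes> e1 \<oplus> e2 \<otimes> j \<ominus> e0"
    unfolding e2u by (simp add: u_def)
  also have "\<dots> = e2 \<otimes> j \<ominus> j \<otimes> e1 \<oplus> (e1 \<ominus> e0)"
    using e2c j c e1c(1) by algebra
  also have "\<dots> = e2 \<otimes> j \<ominus> j \<otimes> e1 \<oplus> j"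
    by (simp only: j_def)
  also have "\<dots> \<in> ?J"
    using j e1c e2c by (simp add: minus_eq J.I_l_closed J.I_r_closed)
  finally have i: "i \<in> ?J" "i \<in> carrier R"
    using e2c c by (auto simp: i_def)
  define w where "w = e2 \<oplus> (\<one> \<ominus> a) \<otimes> t"
  have "w = \<one> \<ominus> \<ominus> i"
    unfolding w_def e0[symmetric] i_def using e2c c by algebra
  then have w: "w \<in> Units R" "w \<in> carrier R"
    using one_minus_jacobson_radical_Units[of "\<ominus> i"] i by auto
  define v where "v = inv w"
  have v: "v \<in> carrier R" "w \<otimes> v = \<one>"
    using w by (simp_all add: v_def)
  define h where "h = \<one> \<ominus> e2"
  have h: "h \<in> carrier R"
    using e2c by (simp add: h_def)
  have "h \<otimes> e2 = e2 \<ominus> e2 \<otimes> e2"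
    unfolding h_def using e2c by algebra
  then have he2: "h \<otimes> e2 = \<zero>"
    using e2_idem e2c by simp
  \<comment> \<open>Because \<open>h \<otimes> e2 = \<zero>\<close>, this is idempotent for any
    \<open>v\<close>. The choice of \<open>v\<close> as inverse of \<open>w\<close> lets
    \<open>h\<close> be written as w v h in 1 - e, so that w - e2 = (1 - a) t comes out as the left
    factor.\<close>
  define e where "e = e2 \<oplus> e2 \<otimes> v \<otimes> h"
  have "e \<otimes> e = e2 \<otimes> e2 \<oplus> (e2 \<otimes> e2) \<otimes> v \<otimes> h \<oplus> (e2 \<otimes> v) \<otimes> (h \<otimes> e2)
      \<oplus> (e2 \<otimes> v) \<otimes> (h \<otimes> e2) \<otimes> (v \<otimes> h)"
    unfolding e_def using e2c v(1) h by algebra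
  also have "\<dots> = e"
    unfolding e2_idem he2 e_def using e2c v(1) h by simp
  finally have "idempotent_elem R e"
    using e2c v h by (simp add: idempotent_elem_def e_def)
  moreover have "e \<in> principal_right_ideal R a"
  proof -
    have "e = e2 \<otimes> (\<one> \<oplus> v \<otimes> h)"
      unfolding e_def using e2c v(1) h by algebra
    also have "\<dots> = a \<otimes> (s \<otimes> e1 \<otimes> inv u \<otimes> (\<one> \<oplus> v \<otimes> h))"
      by (subst (1) e2_a) (use a c u e1c h v in \<open>simp add: m_assoc\<close>)
    finally show ?thesis
      using c u e1c h v by (auto simp: principal_right_ideal_def)
  qed
  moreover have "\<one> \<ominus> e \<in> principal_right_ideal R (\<one> \<ominus> a)"
  proof -
    have "\<one> \<ominus> e = h \<ominus> e2 \<otimes> v \<otimes> h"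
      unfolding e_def h_def using e2c v(1) by algebra
    also have "\<dots> = (w \<otimes> v \<ominus> e2 \<otimes> v) \<otimes> h"
      unfolding v(2) using e2c v(1) h by algebra
    also have "w \<otimes> v \<ominus> e2 \<otimes> v = (w \<ominus> e2) \<otimes> v"
      using w(2) e2c v(1) by algebra
    also have "w \<ominus> e2 = (\<one> \<ominus> a) \<otimes> t"
      unfolding w_def using a c(2) e2c by algebra
    finally show ?thesis
      using a c e2c v h by (auto simp: principal_right_ideal_def m_assoc)
  qed
  ultimately show "\<exists>e. idempotent_elem R e \<and> e \<in> principal_right_ideal R a \<and>
      \<one> \<ominus> e \<in> principal_right_ideal R (\<one> \<ominus> a)"
    by blast
qed

end

theorem theorem3p7:
  fixes R :: "('a, 'b) ring_scheme"
  assumes "ring R"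
  shows "(semi_regular R \<and> WDeltaU R \<longleftrightarrow> exchange_ring R \<and> WDeltaU R) \<and>
         (exchange_ring R \<and> WDeltaU R \<longleftrightarrow> semi_weakly_boolean R)"
proof -
  interpret ring R by fact
  show ?thesis
    using semi_regular_imp_exchange exchange_WDeltaU_imp_semi_weakly_boolean
      semi_weakly_boolean_imp_semi_regular semi_weakly_boolean_imp_WDeltaU by blast
qed

end
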